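(* For every graph $G$ and every 2-switch $\tau$ on $G$, $|\alpha(\tau(G))-\alpha(G)|\le 1$, where $\alpha$ denotes the independence number.
   Context: Graphs are finite and simple. A 2-switch on $G$ is specified by four distinct vertices $a,b,c,d$ with $ab,cd\in E(G)$ and $ac,bd\notin E(G)$; it produces $\tau(G)=G-ab-cd+ac+bd$. $\alpha(G)$ is the maximum size of a set of pairwise non-adjacent vertices of $G$. *)

theory Defs
  imports "Graph_Theory.Pair_Digraph"
begin

text \<open>
  Finite simple graphs are represented by \<^locale>\<open>pair_graph\<close>: an undirected edge \<open>uv\<close> is the pair
  of arcs \<open>(u, v)\<close> and \<open>(v, u)\<close>. Hence deleting or adding an edge deletes or adds both arcs.
\<close>

definition two_switch_on :: "'a pair_pre_digraph \<Rightarrow> 'a \<Rightarrow> 'a \<Rightarrow> 'a \<Rightarrow> 'a \<Rightarrow> bool" where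
  "two_switch_on G a b c d \<longleftrightarrow>
     distinct [a, b, c, d] \<and>
     (a, b) \<in> parcs G \<and> (c, d) \<in> parcs G \<and> (a, c) \<notin> parcs G \<and> (b, d) \<notin> parcs G"

definition two_switch :: "'a \<Rightarrow> 'a \<Rightarrow> 'a \<Rightarrow> 'a \<Rightarrow> 'a pair_pre_digraph \<Rightarrow> 'a pair_pre_digraph" where
  "two_switch a b c d G =
     \<lparr> pverts = pverts G,
       parcs = (parcs G - {(a, b), (b, a), (c, d), (d, c)}) \<union> {(a, c), (c, a), (b, d), (d, b)} \<rparr>"

definition independent_set :: "'a pair_pre_digraph \<Rightarrow> 'a set \<Rightarrow> bool" where
  "independent_set G S \<longleftrightarrow> S \<subseteq> pverts G \<and> pairwise (\<lambda>u v. (u, v) \<notin> parcs G) S"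

definition independence_number :: "'a pair_pre_digraph \<Rightarrow> nat" where
  "independence_number G = Max (card ` {S. independent_set G S})"

lemma pair_graph_two_switch:
  assumes "pair_graph G" and "two_switch_on G a b c d"
  shows "pair_graph (two_switch a b c d G)"
proof -
  interpret pair_graph G by fact
  have s: "(v, u) \<in> parcs G" if "(u, v) \<in> parcs G" for u v
    using that pair_sym_arcs by (auto simp: symmetric_def dest: symD)
  have "a \<in> pverts G" "b \<in> pverts G" "c \<in> pverts G" "d \<in> pverts G"
    using assms(2) by (auto simp: two_switch_on_def dest: in_arcsD1 in_arcsD2)
  then show ?thesis
    using assms(2) s
    by unfold_locales
      (auto simp: two_switch_def two_switch_on_def symmetric_def sym_def
        dest: in_arcsD1 in_arcsD2 pair_no_loops)
qed

end

theory Submission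
  imports Defs
begin

text \<open>
  An independent set of \<open>G\<close> contains at most one of \<open>a, b\<close>, since \<open>ab\<close> is an edge, so it cannot
  contain both new edges \<open>ac\<close> and \<open>bd\<close>. Deleting one vertex therefore makes it independent in
  \<open>\<tau>(G)\<close>. The converse inequality follows because \<open>\<tau>\<close> is undone by a 2-switch on \<open>\<tau>(G)\<close>.
\<close>

lemma finite_independent_sets:
  assumes "finite (pverts G)"
  shows "finite {S. independent_set G S}"
  by (rule finite_subset[of _ "Pow (pverts G)"]) (use assms in \<open>auto simp: independent_set_def\<close>)

lemma card_le_independence_number:
  assumes "finite (pverts G)" and "independent_set G S"
  shows "card S \<le> independence_number G"
  using assms finite_independent_sets[of G] by (auto simp: independence_number_def intro: Max_ge)

lemma obtain_maximum_independent_set: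
  assumes "finite (pverts G)"
  obtains S where "independent_set G S" and "card S = independence_number G"
proof -
  \<comment> \<open>The empty set makes the family nonempty, so that \<open>Max\<close> is
    attained.\<close>
  have "independent_set G {}"
    by (simp add: independent_set_def)
  then have "Max (card ` {S. independent_set G S}) \<in> card ` {S. independent_set G S}"
    using finite_independent_sets[OF assms] by (intro Max_in) auto
  then show ?thesis
    using that by (auto simp: independence_number_def)
qed

lemma independent_set_two_switch_remove1:
  assumes "two_switch_on G a b c d" and "independent_set G S"
  obtains x where "independent_set (two_switch a b c d G) (S - {x})"
proof
  \<comment> \<open>If \<open>a\<close> and \<open>c\<close> both lie in \<open>S\<close>, removing
    \<open>a\<close> breaks \<open>ac\<close>, and \<open>bd\<close> is harmless because the edge
    \<open>ab\<close> keeps \<open>b\<close> out of \<open>S\<close>. Otherwise only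
    \<open>bd\<close> can do harm, and removing \<open>b\<close> breaks it.\<close>
  show "independent_set (two_switch a b c d G) (S - {if a \<in> S \<and> c \<in> S then a else b})"
    using assms
    by (auto simp: independent_set_def two_switch_on_def two_switch_def pairwise_def)
qed

lemma independence_number_le_two_switch:
  assumes "finite (pverts G)" and "two_switch_on G a b c d"
  shows "independence_number G \<le> Suc (independence_number (two_switch a b c d G))"
proof -
  obtain S where S: "independent_set G S" "card S = independence_number G"
    using assms(1) by (rule obtain_maximum_independent_set)
  obtain x where x: "independent_set (two_switch a b c d G) (S - {x})"
    using assms(2) S(1) by (rule independent_set_two_switch_remove1)
  have "card (S - {x}) \<le> independence_number (two_switch a b c d G)"
    by (rule card_le_independence_number[OF _ x]) (simp add: two_switch_def assms(1))
  \<comment> \<open>The vertex \<open>x\<close> may lie outside \<open>S\<close>, hence an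
    inequality.\<close>
  moreover have "card S \<le> Suc (card (S - {x}))"
    using diff_card_le_card_Diff[of "{x}" S] by simp
  ultimately show ?thesis
    using S(2) by simp
qed

text \<open>Exchanging the roles of \<open>b\<close> and \<open>c\<close> gives the inverse switch:
  \<open>ac\<close> and \<open>bd\<close> are now edges, and \<open>ab\<close> and \<open>cd\<close>
  have been deleted.\<close>

lemma two_switch_on_two_switch:
  assumes "two_switch_on G a b c d"
  shows "two_switch_on (two_switch a b c d G) a c b d"
  using assms by (auto simp: two_switch_on_def two_switch_def)

text \<open>\<open>two_switch_on\<close> speaks of only one arc per edge; symmetry of
  \<open>G\<close> settles the reverse arcs, so that exactly the original arcs return.\<close>

lemma two_switch_two_switch:
  assumes "pair_graph G" and "two_switch_on G a b c d"
  shows "two_switch a c b d (two_switch a b c d G) = G"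
proof -
  interpret pair_graph G by fact
  have "(u, v) \<in> parcs G \<longleftrightarrow> (v, u) \<in> parcs G" for u v
    using pair_sym_arcs by (auto simp: symmetric_def dest: symD)
  then have "parcs (two_switch a c b d (two_switch a b c d G)) = parcs G"
    using assms(2) by (auto simp: two_switch_on_def two_switch_def)
  then show ?thesis
    by (simp add: two_switch_def)
qed

theorem mainTheorem10:
  fixes G :: "'a pair_pre_digraph" and a b c d :: 'a
  assumes "pair_graph G"
    and "two_switch_on G a b c d"
  shows "\<bar>int (independence_number (two_switch a b c d G)) - int (independence_number G)\<bar> \<le> 1"
proof -
  interpret pair_graph G by fact
  let ?H = "two_switch a b c d G"
  have "finite (pverts G)" "finite (pverts ?H)"
    by (simp_all add: two_switch_def)
  then have "independence_number G \<le> Suc (independence_number ?H)"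
    and "independence_number ?H \<le> Suc (independence_number G)"
    \<comment> \<open>The second instance applies the inverse switch to \<open>?H\<close>, whose
      result is \<open>G\<close>.\<close>
    using independence_number_le_two_switch[OF _ assms(2)]
      independence_number_le_two_switch[OF _ two_switch_on_two_switch[OF assms(2)]]
    by (simp_all add: two_switch_two_switch[OF assms])
  then show ?thesis
    by linarith
qed

end
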